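(* Let $d$ be a nonnegative integer and let $A\in \mathrm{Mat}_{d+1}(\mathbb{R})$ be a nonnegative matrix (every entry is nonnegative). Then for all $0\le s,t\le d$ the following are equivalent. (i) The directed graph $\Gamma(A)$ is a bidirected path with endpoints $s,t$: $s\leftrightarrow *\leftrightarrow *\leftrightarrow\cdots\leftrightarrow *\leftrightarrow t$. (ii) The matrix $A$ is symmetrizable and multiplicity-free. Moreover, with $\{\theta_i\}_{i=0}^d$ an ordering of the eigenvalues of $A$ and $E_i$ the primitive idempotent of $A$ associated with $\theta_i$, the $(s,t)$-entry of $E_i$ times $$(\theta_i-\theta_0)\cdots(\theta_i-\theta_{i-1})(\theta_i-\theta_{i+1})\cdots(\theta_i-\theta_d)$$ is independent of $i$ for $0\le i\le d$, and this common value is nonzero.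
   Context: $\mathrm{Mat}_{d+1}(\mathbb{R})$ is the algebra of $(d+1)\times(d+1)$ real matrices, with rows and columns indexed by $0,1,\ldots,d$; it acts on $V=\mathbb{R}^{d+1}$ by left multiplication. $\Gamma(A)$ is the directed graph with vertex set $\{0,1,\ldots,d\}$, where $i\rightarrow j$ whenever $i\ne j$ and $A_{ij}\neq 0$. It is a bidirected path with endpoints $s,t$ whenever there is an ordering $x_0,x_1,\ldots,x_d$ of its vertices with $x_0=s$, $x_d=t$ such that $x_i\rightarrow x_j$ if and only if $|i-j|=1$ (for $d=0$: a single vertex with $s=t=0$). $A$ is symmetrizable whenever there exists an invertible diagonal matrix $\Delta\in\mathrm{Mat}_{d+1}(\mathbb{R})$ such that $\Delta A\Delta^{-1}$ is symmetric. $A$ is multiplicity-free whenever $A$ is diagonalizable over $\mathbb{R}$ and all its eigenspaces have dimension $1$ (equivalently, the roots of its characteristic polynomial are real and mutually distinct). In this case let $\{\theta_i\}_{i=0}^d$ be an ordering of the eigenvalues of $A$ and let $V_i$ be the eigenspace for $\theta_i$; the primitive idempotent $E_i\in\mathrm{Mat}_{d+1}(\mathbb{R})$ of $A$ associated with $\theta_i$ is defined by $(E_i-I)V_i=0$ and $E_iV_j=0$ for $j\neq i$. Empty products equal $1$. *)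

theory Defs
  imports
    "Graph_Theory.Pair_Digraph"
    "Jordan_Normal_Form.Spectral_Radius"
    "Jordan_Normal_Form.Matrix_Kernel"
begin

definition mat_digraph :: "real mat \<Rightarrow> nat pair_pre_digraph" where
  "mat_digraph A =
     \<lparr> pverts = {..<dim_row A},
       parcs = {(i, j). i < dim_row A \<and> j < dim_row A \<and> i \<noteq> j \<and> A $$ (i, j) \<noteq> 0} \<rparr>"

text \<open>The vertices are ordered as \<open>x 0, \<dots>, x d\<close>; necessarily \<open>d + 1\<close> is the number of vertices.\<close>

definition bidirected_path :: "'a pair_pre_digraph \<Rightarrow> 'a \<Rightarrow> 'a \<Rightarrow> bool" where
  "bidirected_path G s t \<longleftrightarrow>
     (\<exists>d. \<exists>x :: nat \<Rightarrow> 'a.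
        bij_betw x {..d} (pverts G) \<and> x 0 = s \<and> x d = t \<and>
        (\<forall>i\<le>d. \<forall>j\<le>d. (x i \<rightarrow>\<^bsub>with_proj G\<^esub> x j) \<longleftrightarrow> \<bar>int i - int j\<bar> = 1))"

definition symmetrizable_mat :: "real mat \<Rightarrow> bool" where
  "symmetrizable_mat A \<longleftrightarrow>
     (\<exists>\<Delta> \<in> carrier_mat (dim_row A) (dim_row A). \<exists>\<Delta>' \<in> carrier_mat (dim_row A) (dim_row A).
        diagonal_mat \<Delta> \<and> inverts_mat \<Delta> \<Delta>' \<and> inverts_mat \<Delta>' \<Delta> \<and>
        transpose_mat (\<Delta> * A * \<Delta>') = \<Delta> * A * \<Delta>')"

definition diagonalizable_mat :: "real mat \<Rightarrow> bool" where
  "diagonalizable_mat A \<longleftrightarrow> (\<exists>D :: real mat. diagonal_mat D \<and> similar_mat A D)"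

text \<open>Here \<open>char_matrix A \<theta>\<close> is \<open>A - \<theta> I\<close>, so its kernel is the eigenspace of \<open>A\<close> for \<open>\<theta>\<close>.\<close>

definition eigenspace :: "real mat \<Rightarrow> real \<Rightarrow> real vec set" where
  "eigenspace A \<theta> = mat_kernel (char_matrix A \<theta>)"

definition eigenspace_dim :: "real mat \<Rightarrow> real \<Rightarrow> nat" where
  "eigenspace_dim A \<theta> = kernel_dim (char_matrix A \<theta>)"

definition multiplicity_free_mat :: "real mat \<Rightarrow> bool" where
  "multiplicity_free_mat A \<longleftrightarrow>
     diagonalizable_mat A \<and> (\<forall>\<theta> \<in> spectrum A. eigenspace_dim A \<theta> = 1)"

text \<open>
  For diagonalizable \<open>A\<close> the space is the direct sum of the eigenspaces of \<open>A\<close>, so that for each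
  eigenvalue \<open>\<theta>\<close> there is exactly one such \<open>E\<close>.
\<close>

definition primitive_idempotent :: "real mat \<Rightarrow> real \<Rightarrow> real mat \<Rightarrow> bool" where
  "primitive_idempotent A \<theta> E \<longleftrightarrow>
     \<theta> \<in> spectrum A \<and> E \<in> carrier_mat (dim_row A) (dim_row A) \<and>
     (\<forall>v \<in> eigenspace A \<theta>. (E - 1\<^sub>m (dim_row A)) *\<^sub>v v = 0\<^sub>v (dim_row A)) \<and>
     (\<forall>\<mu> \<in> spectrum A. \<mu> \<noteq> \<theta> \<longrightarrow> (\<forall>v \<in> eigenspace A \<mu>. E *\<^sub>v v = 0\<^sub>v (dim_row A)))"

end

theory Submission
  imports Defs "Jordan_Normal_Form.Jordan_Normal_Form_Uniqueness"
begin

text \<open>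
  If \<open>A\<close> is multiplicity-free then \<open>A^k = (\<Sum>i. \<theta> i ^ k * E i)\<close>, so \<open>e i = (E i)(s, t)\<close> are the
  weights of a linear functional on polynomials whose moments are the entries \<open>(A^k)(s, t)\<close>.
  By Lagrange interpolation, \<open>e i * (\<Prod>j\<noteq>i. \<theta> i - \<theta> j)\<close> has the constant value \<open>c\<close> iff the moments of
  order \<open>k < d\<close> vanish and the one of order \<open>d\<close> is \<open>c\<close>. As \<open>A\<close> is nonnegative, this holds for some
  \<open>c \<noteq> 0\<close> iff the shortest walk from \<open>s\<close> to \<open>t\<close> has length \<open>d\<close>; such a walk visits every vertex and
  has no shortcut. Conversely, on a bidirected path \<open>A\<close> is self-adjoint for a weighted
  inner product, hence diagonalizable, and an eigenvector is determined by its entry at an end of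
  the path.
\<close>

section \<open>Lagrange interpolation and moments\<close>

text \<open>A polynomial of degree at most \<open>d\<close> equals its interpolant at
  \<open>d + 1\<close> distinct nodes; each \<open>q i\<close> is monic of degree \<open>d\<close>,
  so comparing coefficients of degree \<open>d\<close> gives the formula.\<close>

lemma lagrange_leading_coeff:
  fixes \<theta> :: "'i \<Rightarrow> 'a::field" and p :: "'a poly"
  assumes fin: "finite I" and card: "card I = Suc d" and inj: "inj_on \<theta> I" and deg: "degree p \<le> d"
  shows "coeff p d = (\<Sum>i\<in>I. poly p (\<theta> i) / (\<Prod>j\<in>I - {i}. \<theta> i - \<theta> j))"
proof -
  define q where "q i = (\<Prod>j\<in>I - {i}. [:- \<theta> j, 1:])" for i
  define \<pi> where "\<pi> i = (\<Prod>j\<in>I - {i}. \<theta> i - \<theta> j)" for i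
  have deg_q: "degree (q i) = d" if "i \<in> I" for i
    using that card fin by (simp add: q_def degree_prod_eq_sum_degree)
  have lead_q: "coeff (q i) d = 1" if "i \<in> I" for i
    using monic_prod[of "I - {i}" "\<lambda>j. [:- \<theta> j, 1:]"] deg_q[OF that] by (simp add: q_def)
  have \<pi>_nz: "\<pi> i \<noteq> 0" if "i \<in> I" for i
    using that inj fin by (auto simp: \<pi>_def inj_on_def)
  have q_at: "poly (q i) (\<theta> k) = (if k = i then \<pi> i else 0)" if "i \<in> I" "k \<in> I" for i k
    using that fin by (auto simp: q_def \<pi>_def poly_prod intro!: prod_zero)
  define r where "r = (\<Sum>i\<in>I. Polynomial.smult (poly p (\<theta> i) / \<pi> i) (q i))"
  have "p = r"
  proof (rule poly_eqI_degree[of "\<theta> ` I"])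
    show "poly p x = poly r x" if x: "x \<in> \<theta> ` I" for x
    proof -
      obtain k where k: "k \<in> I" "x = \<theta> k" using x by auto
      have "poly r x = (\<Sum>i\<in>I. if k = i then poly p (\<theta> k) else 0)"
        unfolding r_def poly_sum using k \<pi>_nz by (intro sum.cong) (auto simp: q_at)
      then show ?thesis using k fin by simp
    qed
    show "card (\<theta> ` I) > degree p" using deg card card_image[OF inj] by simp
    have "degree r \<le> d"
      unfolding r_def by (intro degree_sum_le[OF fin]) (simp add: deg_q)
    then show "card (\<theta> ` I) > degree r" using card card_image[OF inj] by simp
  qed
  then have "coeff p d = coeff r d" by simp
  also have "\<dots> = (\<Sum>i\<in>I. poly p (\<theta> i) / \<pi> i)"
    unfolding r_def coeff_sum by (intro sum.cong) (simp_all add: lead_q)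
  finally show ?thesis unfolding \<pi>_def .
qed

text \<open>Both conditions say that the functional \<open>p \<mapsto> \<Sum>i. p (\<theta> i) * e i\<close> takes each polynomial of
  degree at most \<open>d\<close> to \<open>c\<close> times its coefficient of degree \<open>d\<close>.\<close>

lemma constant_weights_iff_moments:
  fixes \<theta> e :: "'i \<Rightarrow> 'a::field"
  assumes fin: "finite I" and card: "card I = Suc d" and inj: "inj_on \<theta> I"
  shows "(\<forall>i\<in>I. e i * (\<Prod>j\<in>I - {i}. \<theta> i - \<theta> j) = c) \<longleftrightarrow>
    (\<forall>k<d. (\<Sum>i\<in>I. \<theta> i ^ k * e i) = 0) \<and> (\<Sum>i\<in>I. \<theta> i ^ d * e i) = c"
proof
  assume *: "\<forall>i\<in>I. e i * (\<Prod>j\<in>I - {i}. \<theta> i - \<theta> j) = c"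
  have e: "e i = c / (\<Prod>j\<in>I - {i}. \<theta> i - \<theta> j)" if "i \<in> I" for i
  proof -
    have "(\<Prod>j\<in>I - {i}. \<theta> i - \<theta> j) \<noteq> 0"
      using that inj fin by (auto simp: inj_on_def)
    then show ?thesis using * that by (simp add: field_simps)
  qed
  have "(\<Sum>i\<in>I. \<theta> i ^ k * e i) = c * coeff (monom 1 k) d" if "k \<le> d" for k
  proof -
    have "degree (monom (1::'a) k) \<le> d" using that by (simp add: degree_monom_eq)
    from lagrange_leading_coeff[OF fin card inj this] show ?thesis
      by (simp add: e poly_monom sum_distrib_left mult.commute)
  qed
  then show "(\<forall>k<d. (\<Sum>i\<in>I. \<theta> i ^ k * e i) = 0) \<and> (\<Sum>i\<in>I. \<theta> i ^ d * e i) = c"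
    by simp
next
  assume *: "(\<forall>k<d. (\<Sum>i\<in>I. \<theta> i ^ k * e i) = 0) \<and> (\<Sum>i\<in>I. \<theta> i ^ d * e i) = c"
  show "\<forall>i\<in>I. e i * (\<Prod>j\<in>I - {i}. \<theta> i - \<theta> j) = c"
  proof
    fix i assume i: "i \<in> I"
    \<comment> \<open>\<open>q\<close> vanishes at all nodes but \<open>\<theta> i\<close>, so the
      functional isolates \<open>e i\<close>; as \<open>q\<close> is monic of degree
      \<open>d\<close>, the moments evaluate the functional to \<open>c\<close>.\<close>
    define q where "q = (\<Prod>j\<in>I - {i}. [:- \<theta> j, 1:])"
    have deg_q: "degree q = d"
      using i card fin by (simp add: q_def degree_prod_eq_sum_degree)
    have lead_q: "coeff q d = 1"
      using monic_prod[of "I - {i}" "\<lambda>j. [:- \<theta> j, 1:]"] deg_q by (simp add: q_def)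
    have q_at: "poly q (\<theta> k) = (if i = k then (\<Prod>j\<in>I - {i}. \<theta> i - \<theta> j) else 0)" if "k \<in> I" for k
      using that i fin by (auto simp: q_def poly_prod intro!: prod_zero)
    have "(\<Sum>l\<in>I. poly q (\<theta> l) * e l) = (\<Sum>l\<in>I. \<Sum>k\<le>d. coeff q k * (\<theta> l ^ k * e l))"
      by (simp add: poly_altdef deg_q sum_distrib_right mult.assoc)
    also have "\<dots> = (\<Sum>k\<le>d. coeff q k * (\<Sum>l\<in>I. \<theta> l ^ k * e l))"
      by (subst sum.swap) (simp add: sum_distrib_left)
    also have "\<dots> = (\<Sum>k\<le>d. if k = d then c else 0)"
      using * lead_q by (intro sum.cong) auto
    also have "\<dots> = c" by simp
    finally have "(\<Sum>l\<in>I. poly q (\<theta> l) * e l) = c" .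
    moreover have "(\<Sum>l\<in>I. poly q (\<theta> l) * e l)
        = (\<Sum>l\<in>I. if i = l then (\<Prod>j\<in>I - {i}. \<theta> i - \<theta> j) * e l else 0)"
      by (intro sum.cong) (auto simp: q_at)
    ultimately show "e i * (\<Prod>j\<in>I - {i}. \<theta> i - \<theta> j) = c"
      using i fin by (simp add: mult.commute)
  qed
qed

section \<open>Walks and paths\<close>

text \<open>A repeated vertex could be cut out together with the loop it closes, and an arc jumping
  ahead is a shortcut; either gives a walk of length less than \<open>d\<close>.\<close>

lemma relpow_shortest_path:
  fixes R :: "('a \<times> 'a) set"
  assumes xR: "\<And>i. i < d \<Longrightarrow> (x i, x (Suc i)) \<in> R"
    and short: "\<And>k. k < d \<Longrightarrow> (x 0, x d) \<notin> R ^^ k"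
    and ij: "i < j" "j \<le> d"
  shows "x i \<noteq> x j" and "(x i, x j) \<in> R \<Longrightarrow> j = Suc i"
proof -
  have walk: "(x a, x (a + b)) \<in> R ^^ b" if "a + b \<le> d" for a b
    using that by (induction b) (use xR in \<open>auto intro!: relpow_Suc_I\<close>)
  have pre: "(x 0, x i) \<in> R ^^ i" and post: "(x j, x d) \<in> R ^^ (d - j)"
    using walk[of 0 i] walk[of j "d - j"] ij by auto
  show "x i \<noteq> x j"
  proof
    assume "x i = x j"
    with pre post have "(x 0, x d) \<in> R ^^ (i + (d - j))"
      by (auto simp: relpow_add)
    with short[of "i + (d - j)"] ij show False by simp
  qed
  assume "(x i, x j) \<in> R"
  with pre post have "(x 0, x d) \<in> R ^^ (Suc i + (d - j))"
    by (auto simp: relpow_add simp del: add_Suc)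
  with short[of "Suc i + (d - j)"] ij show "j = Suc i" by (cases "j = Suc i") auto
qed

text \<open>Loops are kept, in contrast to the arcs of \<open>mat_digraph\<close>, because diagonal
  entries contribute to matrix powers.\<close>

definition mat_rel :: "'a::zero mat \<Rightarrow> (nat \<times> nat) set" where
  "mat_rel A = {(i, j). i < dim_row A \<and> j < dim_col A \<and> A $$ (i, j) \<noteq> 0}"

text \<open>An entry of the power is a sum over walks of products of entries, and nonnegativity
  excludes cancellation.\<close>

lemma nonneg_pow_mat_entry:
  fixes A :: "'a::linordered_idom mat"
  assumes A: "A \<in> carrier_mat n n" and nn: "\<And>i j. i < n \<Longrightarrow> j < n \<Longrightarrow> 0 \<le> A $$ (i, j)"
    and "a < n" "b < n"
  shows "0 \<le> (A ^\<^sub>m k) $$ (a, b) \<and> ((A ^\<^sub>m k) $$ (a, b) \<noteq> 0 \<longleftrightarrow> (a, b) \<in> mat_rel A ^^ k)"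
  using \<open>b < n\<close>
proof (induction k arbitrary: b)
  case 0
  then show ?case using A \<open>a < n\<close> by auto
next
  case (Suc k)
  have Ak: "A ^\<^sub>m k \<in> carrier_mat n n" using A by simp
  have eq: "(A ^\<^sub>m Suc k) $$ (a, b) = (\<Sum>c<n. (A ^\<^sub>m k) $$ (a, c) * A $$ (c, b))"
    using A Ak \<open>a < n\<close> \<open>b < n\<close> by (auto simp: scalar_prod_def atLeast0LessThan intro!: sum.cong)
  have nn': "0 \<le> (A ^\<^sub>m k) $$ (a, c) * A $$ (c, b)" if "c < n" for c
    using Suc that nn by simp
  have "(A ^\<^sub>m Suc k) $$ (a, b) \<noteq> 0 \<longleftrightarrow> (\<exists>c<n. (A ^\<^sub>m k) $$ (a, c) \<noteq> 0 \<and> A $$ (c, b) \<noteq> 0)"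
    unfolding eq using nn' by (subst sum_nonneg_eq_0_iff) auto
  also have "\<dots> \<longleftrightarrow> (a, b) \<in> mat_rel A ^^ Suc k"
    using Suc A by (auto simp: mat_rel_def relcomp_unfold)
  finally show ?case using nn' unfolding eq by (auto intro!: sum_nonneg)
qed

lemma dominates_mat_digraph:
  "i \<rightarrow>\<^bsub>with_proj (mat_digraph A)\<^esub> j \<longleftrightarrow>
    i < dim_row A \<and> j < dim_row A \<and> i \<noteq> j \<and> A $$ (i, j) \<noteq> 0"
  by (auto simp: mat_digraph_def arcs_ends_def arc_to_ends_def)

text \<open>On a path a step changes the position by at most one, so crossing from end to end takes
  \<open>d\<close> steps. Conversely, a shortest walk of length \<open>d\<close> has
  \<open>d + 1\<close> distinct vertices, hence all of them, and no shortcut; the symmetric pattern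
  supplies the arcs back.\<close>

lemma bidirected_path_iff_shortest_walk:
  assumes A: "A \<in> carrier_mat (Suc d) (Suc d)" and st: "s \<le> d" "t \<le> d"
  shows "bidirected_path (mat_digraph A) s t \<longleftrightarrow>
    (\<forall>i\<le>d. \<forall>j\<le>d. A $$ (i, j) \<noteq> 0 \<longleftrightarrow> A $$ (j, i) \<noteq> 0) \<and>
    (\<forall>k<d. (s, t) \<notin> mat_rel A ^^ k) \<and> (s, t) \<in> mat_rel A ^^ d"
    (is "_ \<longleftrightarrow> ?sym \<and> ?short \<and> ?walk")
proof
  assume "bidirected_path (mat_digraph A) s t"
  then obtain d' x where x: "bij_betw x {..d'} {..<Suc d}" "x 0 = s" "x d' = t"
    and arc': "\<And>i j. i \<le> d' \<Longrightarrow> j \<le> d' \<Longrightarrow>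
      (x i < Suc d \<and> x j < Suc d \<and> x i \<noteq> x j \<and> A $$ (x i, x j) \<noteq> 0) \<longleftrightarrow> \<bar>int i - int j\<bar> = 1"
    using A unfolding bidirected_path_def dominates_mat_digraph
    by (fastforce simp: mat_digraph_def)
  \<comment> \<open>\<open>bidirected_path\<close> leaves the length open; counting vertices fixes
    it.\<close>
  have d': "d' = d" using bij_betw_same_card[OF x(1)] by simp
  note x = x[unfolded d']
  have inj: "inj_on x {..d}" using x(1) by (simp add: bij_betw_def)
  have ran: "x i \<le> d" if "i \<le> d" for i using bij_betwE[OF x(1)] that by (simp add: less_Suc_eq_le)
  have arc: "A $$ (x i, x j) \<noteq> 0 \<longleftrightarrow> \<bar>int i - int j\<bar> = 1" if "i \<le> d" "j \<le> d" "i \<noteq> j" for i j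
    using arc'[of i j] that ran inj unfolding d' by (auto simp: less_Suc_eq_le inj_on_def)
  have surj: "\<exists>a\<le>d. i = x a" if "i \<le> d" for i
    using bij_betw_imp_surj_on[OF x(1)] that by (auto simp: image_def less_Suc_eq_le)
  have ?sym
  proof (intro allI impI)
    fix i j assume "i \<le> d" "j \<le> d"
    then obtain a b where "a \<le> d" "b \<le> d" "i = x a" "j = x b" using surj by metis
    then show "A $$ (i, j) \<noteq> 0 \<longleftrightarrow> A $$ (j, i) \<noteq> 0"
      by (cases "a = b") (auto simp: arc)
  qed
  \<comment> \<open>Steps may also go back or stay put along a loop, so \<open>k\<close> only bounds
    the position from above.\<close>
  moreover have reach: "\<exists>j\<le>d. j \<le> k \<and> b = x j" if "(s, b) \<in> mat_rel A ^^ k" for k b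
    using that
  proof (induction k arbitrary: b)
    case 0
    then show ?case using x(2) by auto
  next
    case (Suc k)
    then obtain c where c: "(s, c) \<in> mat_rel A ^^ k" "(c, b) \<in> mat_rel A" by auto
    then obtain i where i: "i \<le> d" "i \<le> k" "c = x i" using Suc by blast
    have "b \<le> d" using c(2) A by (auto simp: mat_rel_def)
    then obtain j where j: "j \<le> d" "b = x j" using surj by blast
    have "i = j \<or> \<bar>int i - int j\<bar> = 1" using arc[of i j] i j c(2) by (auto simp: mat_rel_def)
    then show ?case using i j by (intro exI[of _ j]) auto
  qed
  have ?short
  proof (intro allI impI notI)
    fix k assume "k < d" "(s, t) \<in> mat_rel A ^^ k"
    then obtain j where "j \<le> d" "j \<le> k" "x d = x j" using reach x(3) by blast
    then show False using inj_onD[OF inj, of d j] \<open>k < d\<close> by simp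
  qed
  moreover have ?walk
    unfolding relpow_fun_conv using x arc ran A
    by (intro exI[of _ x]) (auto simp: mat_rel_def less_Suc_eq_le)
  ultimately show "?sym \<and> ?short \<and> ?walk" by blast
next
  assume *: "?sym \<and> ?short \<and> ?walk"
  then obtain x where x: "x 0 = s" "x d = t" "\<And>i. i < d \<Longrightarrow> (x i, x (Suc i)) \<in> mat_rel A"
    by (auto simp: relpow_fun_conv)
  have short: "(x 0, x d) \<notin> mat_rel A ^^ k" if "k < d" for k
    using that * x by simp
  note sp = relpow_shortest_path[of d x, OF x(3) short]
  have ran: "x i < Suc d" if "i \<le> d" for i
    using x(3)[of i] that x(2) st A by (cases "i = d") (auto simp: mat_rel_def)
  have inj: "inj_on x {..d}"
    using sp(1) by (intro inj_onI) (metis atMost_iff linorder_neqE_nat)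
  then have bij: "bij_betw x {..d} {..<Suc d}"
    using ran by (intro bij_betw_imageI card_subset_eq) (auto simp: card_image)
  have up: "A $$ (x i, x j) \<noteq> 0 \<longleftrightarrow> j = Suc i" if "i < j" "j \<le> d" for i j
    using sp(2)[OF _ _ that] x(3)[of i] that ran A by (auto simp: mat_rel_def)
  have "A $$ (x i, x j) \<noteq> 0 \<and> i \<noteq> j \<longleftrightarrow> \<bar>int i - int j\<bar> = 1" if "i \<le> d" "j \<le> d" for i j
  proof -
    have "A $$ (x i, x j) \<noteq> 0 \<longleftrightarrow> A $$ (x j, x i) \<noteq> 0"
      using * ran that by (simp add: less_Suc_eq_le)
    then show ?thesis using up[of i j] up[of j i] that
      by (cases i j rule: linorder_cases) auto
  qed
  moreover have "x i = x j \<longleftrightarrow> i = j" if "i \<le> d" "j \<le> d" for i j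
    using inj that by (auto simp: inj_on_def)
  ultimately show "bidirected_path (mat_digraph A) s t"
    unfolding bidirected_path_def dominates_mat_digraph using bij x A ran
    by (intro exI[of _ d] exI[of _ x]) (auto simp: mat_digraph_def)
qed

section \<open>Multiplicity-free matrices\<close>

text \<open>This lets facts about Jordan normal forms yield spectra and eigenspace dimensions of
  diagonalizable matrices.\<close>

lemma jordan_matrix_size_one:
  "jordan_matrix (map (Pair 1) as) = mat_diag (length as) ((!) as)"
proof (induction as)
  case Nil
  then show ?case by (intro eq_matI) (auto simp: jordan_matrix_def mat_diag_def)
next
  case (Cons a as)
  have len: "sum_list (map fst (map (Pair (1::nat)) as)) = length as"
    by (simp add: comp_def sum_list_triv)
  have "jordan_matrix (map (Pair 1) (a # as)) = four_block_mat (jordan_block 1 a) (0\<^sub>m 1 (length as))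
      (0\<^sub>m (length as) 1) (mat_diag (length as) ((!) as))"
    unfolding list.map jordan_matrix_Cons len Cons.IH ..
  also have "\<dots> = mat_diag (length (a # as)) ((!) (a # as))"
  proof (rule eq_matI)
    fix i j assume "i < dim_row (mat_diag (length (a # as)) ((!) (a # as)))"
      "j < dim_col (mat_diag (length (a # as)) ((!) (a # as)))"
    then show "four_block_mat (jordan_block 1 a) (0\<^sub>m 1 (length as))
      (0\<^sub>m (length as) 1) (mat_diag (length as) ((!) as)) $$ (i, j) =
      mat_diag (length (a # as)) ((!) (a # as)) $$ (i, j)"
      by (cases i; cases j) (simp_all add: mat_diag_def)
  qed (simp_all add: mat_diag_def)
  finally show ?case .
qed

lemma jordan_nf_diag:
  fixes as :: "'a::field list"
  assumes "similar_mat A (mat_diag (length as) ((!) as))"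
  shows "jordan_nf A (map (Pair 1) as)"
  using assms unfolding jordan_nf_def jordan_matrix_size_one[symmetric] by auto

text \<open>The eigenspace is the generalized eigenspace of order one, to which each Jordan block
  for \<open>e\<close> contributes one dimension.\<close>

lemma eigenspace_dim_similar_diag:
  assumes "similar_mat A (mat_diag (length as) ((!) as))"
  shows "eigenspace_dim A e = count_list as e"
proof -
  obtain n where A: "A \<in> carrier_mat n n" using similar_matD[OF assms] by blast
  then have "eigenspace_dim A e = dim_gen_eigenspace A e 1"
    by (simp add: eigenspace_dim_def dim_gen_eigenspace_def)
  also have "\<dots> = count_list as e"
    unfolding dim_gen_eigenspace[OF jordan_nf_diag[OF assms]] by (induction as) auto
  finally show ?thesis .
qed

lemma spectrum_similar_diag:
  fixes A :: "'a::field mat"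
  assumes "similar_mat A (mat_diag (length as) ((!) as))"
  shows "spectrum A = set as"
proof -
  obtain n where A: "A \<in> carrier_mat n n" using similar_matD[OF assms] by blast
  have "char_poly A = (\<Prod>a\<leftarrow>as. [:- a, 1:])"
    unfolding jordan_nf_char_poly[OF jordan_nf_diag[OF assms]] by (simp add: comp_def)
  then show ?thesis
    unfolding spectrum_root_char_poly[OF A] by (auto simp: poly_prod_list prod_list_zero_iff)
qed

text \<open>An eigenspace has as many dimensions as its eigenvalue has occurrences on the diagonal,
  so dimension one throughout means no repetition.\<close>

lemma multiplicity_free_mat_iff:
  "multiplicity_free_mat A \<longleftrightarrow> (\<exists>as. distinct as \<and> similar_mat A (mat_diag (length as) ((!) as)))"
proof
  assume mf: "multiplicity_free_mat A"
  then obtain D where D: "diagonal_mat D" "similar_mat A D"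
    by (auto simp: multiplicity_free_mat_def diagonalizable_mat_def)
  obtain n where n: "D \<in> carrier_mat n n" using similar_matD[OF D(2)] by blast
  define as where "as = map (\<lambda>i. D $$ (i, i)) [0..<n]"
  have "D = mat_diag (length as) ((!) as)"
    using D(1) n by (intro eq_matI) (auto simp: as_def mat_diag_def diagonal_mat_def)
  with D have sim: "similar_mat A (mat_diag (length as) ((!) as))" by simp
  have "count_list as a = 1" if "a \<in> set as" for a
    using mf that eigenspace_dim_similar_diag[OF sim] spectrum_similar_diag[OF sim]
    by (simp add: multiplicity_free_mat_def)
  then have "distinct as"
    by (simp add: distinct_count_atmost_1 count_mset count_list_0_iff)
  with sim show "\<exists>as. distinct as \<and> similar_mat A (mat_diag (length as) ((!) as))" by blast
next
  assume "\<exists>as. distinct as \<and> similar_mat A (mat_diag (length as) ((!) as))"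
  then obtain as where as: "distinct as" and sim: "similar_mat A (mat_diag (length as) ((!) as))"
    by blast
  have "diagonal_mat (mat_diag (length as) ((!) as))" by (simp add: diagonal_mat_def mat_diag_def)
  moreover have "eigenspace_dim A a = 1" if "a \<in> spectrum A" for a
    using that as unfolding spectrum_similar_diag[OF sim] eigenspace_dim_similar_diag[OF sim]
    by (metis count_mset distinct_count_atmost_1)
  ultimately show "multiplicity_free_mat A"
    using sim by (auto simp: multiplicity_free_mat_def diagonalizable_mat_def)
qed

section \<open>Eigenspaces and eigenbases\<close>

lemma eigenspace_iff:
  assumes A: "A \<in> carrier_mat n n"
  shows "v \<in> eigenspace A \<mu> \<longleftrightarrow> v \<in> carrier_vec n \<and> A *\<^sub>v v = \<mu> \<cdot>\<^sub>v v"
proof (cases "v = 0\<^sub>v n")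
  \<comment> \<open>The zero vector lies in every eigenspace, but \<open>eigenvector\<close>
    excludes it.\<close>
  case True
  have "B *\<^sub>v 0\<^sub>v n = 0\<^sub>v n" if "B \<in> carrier_mat n n" for B :: "real mat"
    using that by auto
  from this[OF A] this[OF char_matrix_closed[OF A]] True show ?thesis
    by (auto simp: eigenspace_def mat_kernel[OF char_matrix_closed[OF A]])
next
  case False
  then show ?thesis
    using eigenvector_char_matrix[OF A, of v \<mu>] A
    by (auto simp: eigenspace_def mat_kernel[OF char_matrix_closed[OF A]] eigenvector_def)
qed

text \<open>The similarity reads \<open>A * P = P * mat_diag n f\<close>, column by column; no
  column of \<open>P\<close> vanishes because \<open>Q * P\<close> is the identity.\<close>

lemma eigenvector_col_similar_diag:
  fixes A :: "'a::field mat"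
  assumes A: "A \<in> carrier_mat n n" and wit: "similar_mat_wit A (mat_diag n f) P Q" and i: "i < n"
  shows "eigenvector A (col P i) (f i)"
proof -
  note w = similar_mat_witD2[OF A wit]
  have "A * P = P * mat_diag n f * (Q * P)"
    unfolding w(3)
    by (rule assoc_mult_mat[OF mult_carrier_mat[OF w(6) mat_diag_dim] w(7,6)])
  also have "\<dots> = P * mat_diag n f"
    unfolding w(2) by (rule right_mult_one_mat[OF mult_carrier_mat[OF w(6) mat_diag_dim]])
  finally have AP: "A * P = P * mat_diag n f" .
  have "A *\<^sub>v col P i = col (A * P) i" by (rule col_mult2[OF A w(6) i, symmetric])
  also have "\<dots> = f i \<cdot>\<^sub>v col P i"
    unfolding AP using w(6) i by (subst mat_diag_mult_right[of _ n]) auto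
  finally have "A *\<^sub>v col P i = f i \<cdot>\<^sub>v col P i" .
  moreover have "col P i \<noteq> 0\<^sub>v n"
  proof
    assume 0: "col P i = 0\<^sub>v n"
    have "col (1\<^sub>m n) i = Q *\<^sub>v col P i" using w(2,6,7) i by (metis col_mult2)
    also have "\<dots> = 0\<^sub>v n" unfolding 0 using w(7) by auto
    finally have "1\<^sub>m n $$ (i, i) = (0 :: 'a)"
      using i by (metis index_col index_zero_vec(1) index_one_mat(2,3))
    then show False using i by simp
  qed
  ultimately show ?thesis using w A i by (auto simp: eigenvector_def)
qed

section \<open>Primitive idempotents as spectral projections\<close>

lemma mat_eqI_cols:
  fixes M :: "'a::semiring_1 mat"
  assumes "M \<in> carrier_mat n n" "N \<in> carrier_mat n n" "P \<in> carrier_mat n n" "Q \<in> carrier_mat n n"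
    and PQ: "P * Q = 1\<^sub>m n" and eq: "\<And>i. i < n \<Longrightarrow> M *\<^sub>v col P i = N *\<^sub>v col P i"
  shows "M = N"
proof -
  have "M * P = N * P"
    using assms by (intro mat_col_eqI) (auto simp del: col_mult simp: col_mult2[of _ n n _ n])
  then have "M * (P * Q) = N * (P * Q)"
    using assoc_mult_mat[OF assms(1,3,4)] assoc_mult_mat[OF assms(2,3,4)] by simp
  then show ?thesis using assms by simp
qed

text \<open>The columns of \<open>P\<close> are a basis of eigenvectors, so it suffices to compare
  both sides there: on an eigenvector for \<open>\<theta> l\<close> only \<open>E l\<close>
  survives, and both sides multiply it by \<open>\<theta> l ^ k\<close>.\<close>

lemma pow_mat_eq_sum_idempotents:
  assumes A: "A \<in> carrier_mat n n" and diag: "similar_mat A (mat_diag n f)"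
    and fin: "finite I" and bij: "bij_betw \<theta> I (spectrum A)"
    and E: "\<And>i. i \<in> I \<Longrightarrow> primitive_idempotent A (\<theta> i) (E i)"
    and "a < n" "b < n"
  shows "(A ^\<^sub>m k) $$ (a, b) = (\<Sum>i\<in>I. \<theta> i ^ k * E i $$ (a, b))"
proof -
  obtain P Q where wit: "similar_mat_wit A (mat_diag n f) P Q"
    using diag by (auto simp: similar_mat_def)
  note w = similar_mat_witD2[OF A wit]
  define M where "M = mat n n (\<lambda>(a, b). \<Sum>i\<in>I. \<theta> i ^ k * E i $$ (a, b))"
  have E_carrier: "E i \<in> carrier_mat n n" if "i \<in> I" for i
    using E[OF that] A by (auto simp: primitive_idempotent_def)
  have "A ^\<^sub>m k = M"
  proof (rule mat_eqI_cols[OF _ _ w(6,7,1)])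
    fix m assume "m < n"
    define v where "v = col P m"
    have ev: "eigenvector A v (f m)"
      unfolding v_def by (rule eigenvector_col_similar_diag[OF A wit \<open>m < n\<close>])
    then have v: "v \<in> carrier_vec n" and "f m \<in> spectrum A"
      using A by (auto simp: eigenvector_def spectrum_def eigenvalue_def)
    then obtain l where l: "l \<in> I" "\<theta> l = f m"
      using bij_betw_imp_surj_on[OF bij] by (metis imageE)
    have v_eig: "v \<in> eigenspace A (\<theta> l)"
      using ev v A l by (auto simp: eigenspace_iff[OF A] eigenvector_def)
    have Ev: "E i *\<^sub>v v = (if i = l then v else 0\<^sub>v n)" if i: "i \<in> I" for i
    proof (cases "i = l")
      case True
      then have "(E l - 1\<^sub>m n) *\<^sub>v v = 0\<^sub>v n"
        using E[OF l(1)] v_eig A by (auto simp: primitive_idempotent_def)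
      then have 0: "E l *\<^sub>v v - v = 0\<^sub>v n"
        using v E_carrier[OF l(1)] by (simp add: minus_mult_distrib_mat_vec)
      have "(E l *\<^sub>v v) $ c = v $ c" if "c < n" for c
        using arg_cong[OF 0, of "\<lambda>u. u $ c"] that v E_carrier[OF l(1)] by simp
      then show ?thesis
        using True v E_carrier[OF l(1)] by (intro eq_vecI) auto
    next
      case False
      have "\<theta> l \<in> spectrum A" "\<theta> l \<noteq> \<theta> i"
        using False bij_betwE[OF bij] inj_onD[OF bij_betw_imp_inj_on[OF bij], of i l] i l by auto
      then show ?thesis using E[OF i] v_eig A False by (auto simp: primitive_idempotent_def)
    qed
    have "M *\<^sub>v v = f m ^ k \<cdot>\<^sub>v v"
    proof (rule eq_vecI)
      fix c assume "c < dim_vec (f m ^ k \<cdot>\<^sub>v v)"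
      then have c: "c < n" using v by simp
      have "(M *\<^sub>v v) $ c = (\<Sum>b<n. \<Sum>i\<in>I. \<theta> i ^ k * (E i $$ (c, b) * v $ b))"
        using c v by (simp add: M_def scalar_prod_def atLeast0LessThan sum_distrib_right mult.assoc)
      also have "\<dots> = (\<Sum>i\<in>I. \<theta> i ^ k * (\<Sum>b<n. E i $$ (c, b) * v $ b))"
        by (subst sum.swap) (simp add: sum_distrib_left)
      also have "\<dots> = (\<Sum>i\<in>I. \<theta> i ^ k * (E i *\<^sub>v v) $ c)"
      proof (intro sum.cong refl)
        fix i assume "i \<in> I"
        then have "(E i *\<^sub>v v) $ c = (\<Sum>b<n. E i $$ (c, b) * v $ b)"
          using c v E_carrier[of i] by (auto simp: scalar_prod_def atLeast0LessThan)
        then show "\<theta> i ^ k * (\<Sum>b<n. E i $$ (c, b) * v $ b) = \<theta> i ^ k * (E i *\<^sub>v v) $ c"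
          by simp
      qed
      also have "\<dots> = (\<Sum>i\<in>I. if i = l then \<theta> l ^ k * v $ c else 0)"
        using c Ev by (intro sum.cong) auto
      also have "\<dots> = (f m ^ k \<cdot>\<^sub>v v) $ c" using fin l c v by simp
      finally show "(M *\<^sub>v v) $ c = (f m ^ k \<cdot>\<^sub>v v) $ c" .
    qed (use v in \<open>simp add: M_def\<close>)
    then show "A ^\<^sub>m k *\<^sub>v col P m = M *\<^sub>v col P m"
      using eigenvector_pow[OF A ev] by (simp add: v_def)
  qed (use A in \<open>auto simp: M_def\<close>)
  then show ?thesis using \<open>a < n\<close> \<open>b < n\<close> by (simp add: M_def)
qed

text \<open>The projection onto the \<open>i\<close>-th coordinate in the basis of columns of
  \<open>P\<close> is the idempotent sought.\<close>

lemma primitive_idempotent_exists: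
  assumes A: "A \<in> carrier_mat n n" and diag: "similar_mat A (mat_diag n f)"
    and inj: "inj_on f {..<n}" and i: "i < n"
  shows "\<exists>E. primitive_idempotent A (f i) E"
proof -
  obtain P Q where wit: "similar_mat_wit A (mat_diag n f) P Q"
    using diag by (auto simp: similar_mat_def)
  note w = similar_mat_witD2[OF A wit]
  define E where "E = P * mat_diag n (\<lambda>j. if j = i then 1 else 0) * Q"
  have E: "E \<in> carrier_mat n n"
    unfolding E_def by (intro mult_carrier_mat[OF mult_carrier_mat[OF w(6)] w(7)] mat_diag_dim)
  have "f i \<in> spectrum A"
    using eigenvector_col_similar_diag[OF A wit i] by (auto simp: spectrum_def eigenvalue_def)
  moreover have Ev: "E *\<^sub>v v = (if \<mu> = f i then v else 0\<^sub>v n)" if v_eig: "v \<in> eigenspace A \<mu>" for v \<mu>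
  proof -
    have v: "v \<in> carrier_vec n" and Av: "A *\<^sub>v v = \<mu> \<cdot>\<^sub>v v"
      using v_eig by (auto simp: eigenspace_iff[OF A])
    define u where "u = Q *\<^sub>v v"
    have u: "u \<in> carrier_vec n" using w(1,2,4-7) v by (simp add: u_def)
    have Pu: "P *\<^sub>v u = v"
      unfolding u_def using w(1,2,4-7) v by (simp flip: assoc_mult_mat_vec[of P n n Q n])
    have diag_u: "(mat_diag n g *\<^sub>v u) $ j = g j * u $ j" if "j < n" for g :: "nat \<Rightarrow> real" and j
    proof -
      have "(mat_diag n g *\<^sub>v u) $ j = (\<Sum>k<n. (if j = k then g k else 0) * u $ k)"
        using that u by (simp add: mat_diag_def scalar_prod_def atLeast0LessThan)
      also have "\<dots> = (\<Sum>k<n. if k = j then g j * u $ j else 0)"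
        by (intro sum.cong) auto
      finally have "(mat_diag n g *\<^sub>v u) $ j = (\<Sum>k<n. if k = j then g j * u $ j else 0)" .
      then show ?thesis using that by simp
    qed
    have "\<mu> \<cdot>\<^sub>v u = Q *\<^sub>v (A *\<^sub>v v)" using w(1,2,4-7) v by (simp add: Av u_def mult_mat_vec)
    also have "\<dots> = Q *\<^sub>v (P *\<^sub>v (mat_diag n f *\<^sub>v u))"
        unfolding u_def using w(6,7) v
      by (subst w(3), subst assoc_mult_mat_vec[OF mult_carrier_mat[OF w(6) mat_diag_dim] w(7) v])
        (simp add: assoc_mult_mat_vec[OF w(6) mat_diag_dim])
    also have "\<dots> = mat_diag n f *\<^sub>v u"
      using mult_mat_vec_carrier[OF mat_diag_dim u]
      by (metis assoc_mult_mat_vec one_mult_mat_vec w(2,6,7))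
    finally have *: "\<mu> \<cdot>\<^sub>v u = mat_diag n f *\<^sub>v u" .
    \<comment> \<open>In coordinates the eigenvalue equation is
      \<open>(f j - \<mu>) * u $ j = 0\<close>. So \<open>u\<close> vanishes at \<open>i\<close>
      unless \<open>\<mu> = f i\<close>, and then, \<open>f\<close> being injective, it vanishes
      everywhere else.\<close>
    have eig: "\<mu> = f j \<or> u $ j = 0" if "j < n" for j
      using arg_cong[OF *, of "\<lambda>x. x $ j"] diag_u[OF that, of f] that u by auto
    have "mat_diag n (\<lambda>j. if j = i then 1 else 0) *\<^sub>v u = (if \<mu> = f i then u else 0\<^sub>v n)" (is "?l = ?r")
    proof (rule eq_vecI)
      show "dim_vec ?l = dim_vec ?r" using u by (simp add: mat_diag_def)
      fix j assume "j < dim_vec ?r"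
      then have "j < n" using u by (simp split: if_splits)
      then show "?l $ j = ?r $ j"
        using eig[OF \<open>j < n\<close>] inj_onD[OF inj, of i j] i by (auto simp: diag_u)
    qed
    moreover have "E *\<^sub>v v = P *\<^sub>v (mat_diag n (\<lambda>j. if j = i then 1 else 0) *\<^sub>v u)"
      unfolding E_def u_def using w(6,7) v
      by (subst assoc_mult_mat_vec[OF mult_carrier_mat[OF w(6) mat_diag_dim] w(7) v])
        (simp add: assoc_mult_mat_vec[OF w(6) mat_diag_dim])
    moreover have "P *\<^sub>v 0\<^sub>v n = 0\<^sub>v n" using w(6) by auto
    ultimately show ?thesis using Pu by simp
  qed
  moreover have "(E - 1\<^sub>m n) *\<^sub>v v = 0\<^sub>v n" if "v \<in> eigenspace A (f i)" for v
    using Ev[OF that] that E by (simp add: eigenspace_iff[OF A] minus_mult_distrib_mat_vec)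
  ultimately have "primitive_idempotent A (f i) E"
    using A E by (auto simp: primitive_idempotent_def)
  then show ?thesis ..
qed

section \<open>Matrices that are self-adjoint for a weighted inner product\<close>

text \<open>\<open>w_sym\<close> is detailed balance: \<open>A\<close> is self-adjoint for the inner
  product \<open>\<Sum>i<n. w i * u $ i * v $ i\<close>.\<close>

locale weighted_symmetric_mat =
  fixes n :: nat and A :: "real mat" and w :: "nat \<Rightarrow> real"
  assumes A: "A \<in> carrier_mat n n"
    and w_pos: "\<And>i. i < n \<Longrightarrow> 0 < w i"
    and w_sym: "\<And>i j. i < n \<Longrightarrow> j < n \<Longrightarrow> w i * A $$ (i, j) = w j * A $$ (j, i)"
begin

text \<open>Self-adjointness makes the Hermitian form \<open>S\<close> of \<open>A\<close> at an
  eigenvector real, while \<open>S\<close> is also \<open>\<mu>\<close> times the positive squared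
  weighted norm \<open>N\<close>.\<close>

lemma complex_eigenvalue_real:
  assumes "eigenvalue (map_mat of_real A :: complex mat) \<mu>"
  shows "\<mu> \<in> \<real>"
proof -
  obtain v where v: "v \<in> carrier_vec n" "v \<noteq> 0\<^sub>v n"
    and eig: "map_mat of_real A *\<^sub>v v = \<mu> \<cdot>\<^sub>v v"
    using assms A by (auto simp: eigenvalue_def eigenvector_def)
  have Av: "(\<Sum>j<n. of_real (A $$ (i, j)) * v $ j) = \<mu> * v $ i" if "i < n" for i
    using arg_cong[OF eig, of "\<lambda>u. u $ i"] that v A
    by (simp add: scalar_prod_def atLeast0LessThan)
  define N where "N = (\<Sum>i<n. w i * (cmod (v $ i))\<^sup>2)"
  define S where "S = (\<Sum>i<n. \<Sum>j<n. of_real (w i * A $$ (i, j)) * (cnj (v $ i) * v $ j))"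
  have "S = (\<Sum>i<n. of_real (w i) * cnj (v $ i) * (\<Sum>j<n. of_real (A $$ (i, j)) * v $ j))"
    unfolding S_def by (simp add: sum_distrib_left mult_ac)
  also have "\<dots> = (\<Sum>i<n. \<mu> * of_real (w i * (cmod (v $ i))\<^sup>2))"
  proof (intro sum.cong refl)
    fix i assume "i \<in> {..<n}"
    then have "i < n" by simp
    show "of_real (w i) * cnj (v $ i) * (\<Sum>j<n. of_real (A $$ (i, j)) * v $ j)
      = \<mu> * of_real (w i * (cmod (v $ i))\<^sup>2)"
      unfolding Av[OF \<open>i < n\<close>] by (simp only: of_real_mult complex_norm_square mult_ac)
  qed
  also have "\<dots> = \<mu> * of_real N" by (simp add: N_def sum_distrib_left)
  finally have S: "S = \<mu> * of_real N" .
  have "cnj S = (\<Sum>i<n. \<Sum>j<n. of_real (w i * A $$ (i, j)) * (v $ i * cnj (v $ j)))"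
    by (simp add: S_def)
  also have "\<dots> = S"
    unfolding S_def by (subst sum.swap) (auto intro!: sum.cong simp: w_sym mult.commute)
  finally have "(cnj \<mu> - \<mu>) * of_real N = 0" by (simp add: S algebra_simps)
  moreover have "N > 0"
  proof -
    obtain i where "i < n" "v $ i \<noteq> 0" using v by (metis carrier_vecD eq_vecI index_zero_vec)
    then show ?thesis
      unfolding N_def using w_pos by (intro sum_pos2[of _ i]) (auto simp: less_imp_le)
  qed
  ultimately show ?thesis by (simp add: Reals_cnj_iff)
qed

text \<open>The complex factorization has only real roots, so it comes from a real one; injectivity
  of \<open>of_real\<close> on coefficients carries it back.\<close>

lemma char_poly_splits: "\<exists>as. char_poly A = (\<Prod>a\<leftarrow>as. [:- a, 1:])"
proof -
  have cA: "map_mat complex_of_real A \<in> carrier_mat n n" using A by simp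
  obtain as where as: "char_poly (map_mat complex_of_real A) = (\<Prod>a\<leftarrow>as. [:- a, 1:])"
    using char_poly_factorized[OF cA] by blast
  have "a \<in> \<real>" if "a \<in> set as" for a
    using that complex_eigenvalue_real
    by (simp add: eigenvalue_root_char_poly[OF cA] as poly_prod_list prod_list_zero_iff)
  then have re: "map (of_real \<circ> Re) as = as" by (intro map_idI) (auto simp: of_real_Re)
  interpret map_poly_comm_ring_hom complex_of_real ..
  have "map_poly complex_of_real (char_poly A) = (\<Prod>a\<leftarrow>map (of_real \<circ> Re) as. [:- a, 1:])"
    unfolding re as[symmetric] by (rule of_real_hom.char_poly_hom[OF A, symmetric])
  also have "\<dots> = map_poly of_real (\<Prod>a\<leftarrow>map Re as. [:- a, 1:])"
    by (induction as) (simp_all only: list.map prod_list.Nil prod_list.Cons hom_distribs o_apply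
      map_poly_pCons_hom map_poly_0 one_pCons of_real_1)
  finally have eq: "map_poly complex_of_real (char_poly A)
    = map_poly of_real (\<Prod>a\<leftarrow>map Re as. [:- a, 1:])" .
  have "coeff (char_poly A) k = coeff (\<Prod>a\<leftarrow>map Re as. [:- a, 1:]) k" for k
    using arg_cong[OF eq, of "\<lambda>p. coeff p k"]
    by (simp only: of_real_hom.coeff_map_poly_hom of_real_eq_iff)
  then have "char_poly A = (\<Prod>a\<leftarrow>map Re as. [:- a, 1:])" by (rule poly_eqI)
  then show ?thesis by blast
qed

text \<open>The matrix \<open>B = char_matrix A a\<close> is again self-adjoint. Moving one factor
  across the inner product shows that \<open>B *\<^sub>v v\<close> has norm zero once
  \<open>B\<close> annihilates it.\<close>

lemma kernel_char_matrix_square: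
  "mat_kernel (char_matrix A a ^\<^sub>m 2) = mat_kernel (char_matrix A a)"
proof -
  define B where "B = char_matrix A a"
  have B: "B \<in> carrier_mat n n" using A by (simp add: B_def)
  have B_sym: "w i * B $$ (i, j) = w j * B $$ (j, i)" if "i < n" "j < n" for i j
    using that w_sym[OF that] A by (auto simp: B_def char_matrix_def algebra_simps)
  have "B *\<^sub>v v = 0\<^sub>v n" if v: "v \<in> carrier_vec n" and 0: "B *\<^sub>v (B *\<^sub>v v) = 0\<^sub>v n" for v
  proof -
    define u where "u = B *\<^sub>v v"
    have u: "u \<in> carrier_vec n" using B v by (simp add: u_def)
    have "(\<Sum>i<n. w i * (u $ i)\<^sup>2) = (\<Sum>i<n. \<Sum>j<n. (w i * B $$ (i, j)) * (u $ i * v $ j))"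
    proof (intro sum.cong refl)
      fix i assume "i \<in> {..<n}"
      then have "u $ i = (\<Sum>j<n. B $$ (i, j) * v $ j)"
        using B v by (simp add: u_def scalar_prod_def atLeast0LessThan)
      then have "w i * (u $ i)\<^sup>2 = w i * u $ i * (\<Sum>j<n. B $$ (i, j) * v $ j)"
        by (simp add: power2_eq_square)
      then show "w i * (u $ i)\<^sup>2 = (\<Sum>j<n. (w i * B $$ (i, j)) * (u $ i * v $ j))"
        by (simp add: sum_distrib_left mult_ac)
    qed
    also have "\<dots> = (\<Sum>j<n. \<Sum>i<n. (w j * B $$ (j, i)) * (u $ i * v $ j))"
      by (subst sum.swap) (auto intro!: sum.cong simp: B_sym)
    also have "\<dots> = (\<Sum>j<n. w j * v $ j * (B *\<^sub>v u) $ j)"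
      using B u by (simp add: scalar_prod_def atLeast0LessThan sum_distrib_left mult_ac)
    also have "\<dots> = 0" using 0 by (simp add: u_def)
    finally have "(\<Sum>i<n. w i * (u $ i)\<^sup>2) = 0" .
    then have "\<forall>i<n. w i * (u $ i)\<^sup>2 = 0"
      using w_pos by (subst (asm) sum_nonneg_eq_0_iff) (auto simp: less_imp_le)
    then have "\<forall>i<n. u $ i = 0" using w_pos by force
    then show ?thesis using u by (intro eq_vecI) (auto simp: u_def[symmetric])
  qed
  moreover have "B *\<^sub>v 0\<^sub>v n = 0\<^sub>v n" using B by auto
  ultimately show ?thesis
    using B unfolding B_def[symmetric]
    by (auto simp: mat_kernel[OF B] mat_kernel[of "B * B" n n] numeral_2_eq_2)
qed

text \<open>A Jordan block of size above one would make the kernel of the squared characteristic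
  matrix strictly larger than that of the matrix itself.\<close>

lemma similar_diag: "\<exists>as. similar_mat A (mat_diag (length as) ((!) as))"
proof -
  obtain es where "char_poly A = (\<Prod>a\<leftarrow>es. [:- a, 1:])" using char_poly_splits by blast
  from jordan_nf_exists[OF A this] obtain n_as where jnf: "jordan_nf A n_as" by blast
  \<comment> \<open>The sums are the dimensions of the generalized eigenspaces of orders one and
    two. Since \<open>min 1 k \<le> min 2 k\<close>, equal sums force termwise equality, so
    \<open>k \<le> 1\<close>.\<close>
  have sizes: "list_all (\<lambda>k. k \<le> 1) ks" if "(\<Sum>k\<leftarrow>ks. min 1 k) = (\<Sum>k\<leftarrow>ks. min 2 k)"
    for ks :: "nat list"
    using that
  proof (induction ks)
    case (Cons k ks)
    have "(\<Sum>k\<leftarrow>ks. min 1 k) \<le> (\<Sum>k\<leftarrow>ks. min 2 k)" by (intro sum_list_mono) simp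
    then have "min 1 k = min 2 k" "(\<Sum>k\<leftarrow>ks. min 1 k) = (\<Sum>k\<leftarrow>ks. min 2 k)"
      using Cons.prems by (auto simp: min_def split: if_splits)
    then show ?case using Cons.IH by (auto simp: min_def split: if_splits)
  qed simp
  have "k = 1" if "(k, a) \<in> set n_as" for k a
  proof -
    have "dim_gen_eigenspace A a 1 = dim_gen_eigenspace A a 2"
      using A kernel_char_matrix_square[of a]
      by (simp add: dim_gen_eigenspace_def kernel_dim_def)
    then have "list_all (\<lambda>k. k \<le> 1) (map fst [(k, e)\<leftarrow>n_as . e = a])"
      unfolding dim_gen_eigenspace[OF jnf] by (rule sizes)
    then have "k \<le> 1" using that by (auto simp: list_all_iff)
    moreover have "k \<noteq> 0" using jnf that by (force simp: jordan_nf_def)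
    ultimately show ?thesis by simp
  qed
  then have "map (Pair 1) (map snd n_as) = n_as"
    by (auto intro!: map_idI)
  then have "similar_mat A (jordan_matrix (map (Pair 1) (map snd n_as)))"
    using jnf by (simp add: jordan_nf_def)
  then show ?thesis unfolding jordan_matrix_size_one by blast
qed

end

text \<open>A repeated eigenvalue would have two independent eigenvectors, and a nontrivial
  combination of them would vanish at \<open>r\<close>, against \<open>det\<close>.\<close>

lemma multiplicity_free_mat_if_weighted_symmetric:
  assumes "weighted_symmetric_mat n A w" and r: "r < n"
    and det: "\<And>v \<mu>. v \<in> eigenspace A \<mu> \<Longrightarrow> v $ r = 0 \<Longrightarrow> v = 0\<^sub>v n"
  shows "multiplicity_free_mat A"
proof -
  interpret weighted_symmetric_mat n A w by fact
  obtain as where sim: "similar_mat A (mat_diag (length as) ((!) as))" using similar_diag by blast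
  then obtain P Q where wit': "similar_mat_wit A (mat_diag (length as) ((!) as)) P Q"
    by (auto simp: similar_mat_def)
  have len: "length as = n"
    using carrier_matD(1)[OF similar_mat_witD2(5)[OF A wit']]
      carrier_matD(1)[OF mat_diag_dim[of "length as" "(!) as"]] by simp
  note wit = wit'[unfolded len]
  note w = similar_mat_witD2[OF A wit]
  have "as ! i \<noteq> as ! j" if ij: "i < n" "j < n" "i \<noteq> j" for i j
  proof
    assume eq: "as ! i = as ! j"
    define p q where "p = col P i" and "q = col P j"
    have ev: "eigenvector A p (as ! i)" "eigenvector A q (as ! i)"
      using eigenvector_col_similar_diag[OF A wit ij(1)] eigenvector_col_similar_diag[OF A wit ij(2)]
      by (simp_all add: p_def q_def eq)
    have pq: "p \<in> carrier_vec n" "q \<in> carrier_vec n" "A *\<^sub>v p = as ! i \<cdot>\<^sub>v p" "A *\<^sub>v q = as ! i \<cdot>\<^sub>v q"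
      and nz: "p \<noteq> 0\<^sub>v n"
      using ev A by (auto simp: eigenvector_def)
    have pr: "p $ r \<noteq> 0" using det[of p "as ! i"] pq nz by (auto simp: eigenspace_iff[OF A])
    \<comment> \<open>The coefficients are chosen to cancel the entry at \<open>r\<close>.\<close>
    define v where "v = q $ r \<cdot>\<^sub>v p - p $ r \<cdot>\<^sub>v q"
    have "A *\<^sub>v v = as ! i \<cdot>\<^sub>v v"
      using pq A unfolding v_def
      by (subst mult_minus_distrib_mat_vec[of _ n n]) (auto simp: mult_mat_vec algebra_simps smult_smult_assoc intro!: eq_vecI)
    then have v0: "v = 0\<^sub>v n"
      using pq r by (intro det[of v "as ! i"]) (auto simp: eigenspace_iff[OF A] v_def)
    have Q_col: "Q *\<^sub>v col P k = unit_vec n k" if "k < n" for k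
      using w(2,6,7) that by (metis col_mult2 col_one)
    \<comment> \<open>\<open>Q\<close> recovers coordinates in the basis of columns of
      \<open>P\<close>; the one at \<open>j\<close> is \<open>- p $ r\<close>, nonzero although
      \<open>v\<close> vanishes.\<close>
    have "Q *\<^sub>v v = q $ r \<cdot>\<^sub>v unit_vec n i - p $ r \<cdot>\<^sub>v unit_vec n j"
      using pq w(7) ij unfolding v_def
      by (subst mult_minus_distrib_mat_vec[of _ n n]) (auto simp: mult_mat_vec p_def q_def Q_col)
    moreover have "Q *\<^sub>v v = 0\<^sub>v n" unfolding v0 using w(7) by auto
    ultimately have "(q $ r \<cdot>\<^sub>v unit_vec n i - p $ r \<cdot>\<^sub>v unit_vec n j) $ j = (0\<^sub>v n :: real vec) $ j"
      by simp
    then show False using ij pr by simp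
  qed
  then have "distinct as" by (simp add: distinct_conv_nth len)
  with sim show ?thesis unfolding multiplicity_free_mat_iff by blast
qed

section \<open>Nonnegative matrices of bidirected paths\<close>

locale nonneg_path_mat =
  fixes d :: nat and A :: "real mat" and x :: "nat \<Rightarrow> nat"
  assumes A: "A \<in> carrier_mat (Suc d) (Suc d)"
    and nonneg: "\<And>i j. i \<le> d \<Longrightarrow> j \<le> d \<Longrightarrow> 0 \<le> A $$ (i, j)"
    and bij: "bij_betw x {..d} {..d}"
    and arc: "\<And>i j. i \<le> d \<Longrightarrow> j \<le> d \<Longrightarrow> i \<noteq> j \<Longrightarrow> A $$ (x i, x j) \<noteq> 0 \<longleftrightarrow> \<bar>int i - int j\<bar> = 1"
begin

lemma x_le: "i \<le> d \<Longrightarrow> x i \<le> d"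
  using bij_betwE[OF bij] by simp

lemma x_surj: "i \<le> d \<Longrightarrow> \<exists>k\<le>d. i = x k"
  using bij_betw_imp_surj_on[OF bij] by (metis atMost_iff imageE)

lemma arc_pos: "i \<le> d \<Longrightarrow> j \<le> d \<Longrightarrow> \<bar>int i - int j\<bar> = 1 \<Longrightarrow> 0 < A $$ (x i, x j)"
  using arc[of i j] nonneg[OF x_le x_le, of i j] by force

text \<open>Detailed balance along consecutive vertices, started from weight 1, solves to this
  product, as for the reversible measure of a birth-death chain.\<close>

definition path_weight :: "nat \<Rightarrow> real" where
  "path_weight k = (\<Prod>i<k. A $$ (x i, x (Suc i)) / A $$ (x (Suc i), x i))"

lemma path_weight_pos: "k \<le> d \<Longrightarrow> 0 < path_weight k"
  unfolding path_weight_def by (intro prod_pos) (auto intro!: divide_pos_pos arc_pos)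

lemma path_weight_Suc:
  "Suc k \<le> d \<Longrightarrow> path_weight (Suc k) * A $$ (x (Suc k), x k) = path_weight k * A $$ (x k, x (Suc k))"
  using arc_pos[of "Suc k" k] by (simp add: path_weight_def)

lemma path_weight_sym:
  assumes "i \<le> d" "j \<le> d"
  shows "path_weight i * A $$ (x i, x j) = path_weight j * A $$ (x j, x i)"
proof -
  consider "i = j" | "j = Suc i" | "i = Suc j" | "i \<noteq> j" "\<bar>int i - int j\<bar> \<noteq> 1" by linarith
  then show ?thesis
    using assms path_weight_Suc[of i] path_weight_Suc[of j] arc[of i j] arc[of j i]
    by cases (auto simp: abs_minus_commute)
qed

definition vertex_weight :: "nat \<Rightarrow> real" where
  "vertex_weight = path_weight \<circ> the_inv_into {..d} x"

lemma vertex_weight: "i \<le> d \<Longrightarrow> vertex_weight (x i) = path_weight i"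
  using bij by (simp add: vertex_weight_def the_inv_into_f_f bij_betw_def)

sublocale weighted_symmetric_mat "Suc d" A vertex_weight
proof
  show "A \<in> carrier_mat (Suc d) (Suc d)" by (rule A)
  fix i j assume "i < Suc d" "j < Suc d"
  then obtain k l where "k \<le> d" "i = x k" "l \<le> d" "j = x l"
    using x_surj by (metis less_Suc_eq_le)
  then show "vertex_weight i * A $$ (i, j) = vertex_weight j * A $$ (j, i)"
    by (simp add: vertex_weight path_weight_sym)
next
  fix i assume "i < Suc d"
  then obtain k where "k \<le> d" "i = x k" using x_surj by (metis less_Suc_eq_le)
  then show "0 < vertex_weight i" by (simp add: vertex_weight path_weight_pos)
qed

text \<open>Along the path the eigenvalue equation is a three-term recurrence with nonzero leading
  coefficient, so the entry at one end determines the rest.\<close>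

lemma eigenvector_determined_by_endpoint:
  assumes v: "v \<in> eigenspace A \<mu>" and 0: "v $ x 0 = 0"
  shows "v = 0\<^sub>v (Suc d)"
proof -
  have v_carrier: "v \<in> carrier_vec (Suc d)" and eig: "A *\<^sub>v v = \<mu> \<cdot>\<^sub>v v"
    using v by (auto simp: eigenspace_iff[OF A])
  have row: "(\<Sum>l\<le>d. A $$ (x k, x l) * v $ x l) = \<mu> * v $ x k" if "k \<le> d" for k
  proof -
    have "(\<Sum>l\<le>d. A $$ (x k, x l) * v $ x l) = (\<Sum>j\<le>d. A $$ (x k, j) * v $ j)"
      by (rule sum.reindex_bij_betw[OF bij])
    also have "\<dots> = (A *\<^sub>v v) $ x k"
      using A v_carrier x_le[OF that]
      by (simp add: scalar_prod_def atLeast0LessThan lessThan_Suc_atMost)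
    finally show ?thesis using v_carrier x_le[OF that] by (simp add: eig)
  qed
  have "k \<le> d \<Longrightarrow> v $ x k = 0" for k
  proof (induction k rule: less_induct)
    case (less k)
    show ?case
    proof (cases k)
      case (Suc m)
      \<comment> \<open>Entries of \<open>v\<close> before position \<open>k\<close> vanish by
        induction, and later positions are not adjacent to \<open>m\<close>, so only
        \<open>l = k\<close> survives.\<close>
      have "(\<Sum>l\<le>d. A $$ (x m, x l) * v $ x l) = (\<Sum>l\<le>d. if l = k then A $$ (x m, x k) * v $ x k else 0)"
      proof (intro sum.cong refl)
        fix l assume "l \<in> {..d}"
        then show "A $$ (x m, x l) * v $ x l = (if l = k then A $$ (x m, x k) * v $ x k else 0)"
          using less.IH[of l] less.prems Suc arc[of m l] by (cases l k rule: linorder_cases) auto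
      qed
      then have "A $$ (x m, x k) * v $ x k = 0"
        using row[of m] less.IH[of m] less.prems Suc by simp
      then show ?thesis using arc_pos[of m k] less.prems Suc by auto
    qed (simp add: 0)
  qed
  then have "v $ i = 0" if "i < Suc d" for i
    using x_surj[of i] that by (auto simp: less_Suc_eq_le)
  then show ?thesis using v_carrier by (intro eq_vecI) auto
qed

lemma multiplicity_free: "multiplicity_free_mat A"
  using multiplicity_free_mat_if_weighted_symmetric[OF weighted_symmetric_mat_axioms, of "x 0"]
    eigenvector_determined_by_endpoint x_le[of 0] by (simp add: less_Suc_eq_le)

end

section \<open>Symmetrizability in terms of entries\<close>

lemma symmetrizable_mat_iff:
  assumes A: "A \<in> carrier_mat n n"
  shows "symmetrizable_mat A \<longleftrightarrow>
    (\<exists>\<delta>. \<forall>i<n. \<delta> i \<noteq> 0 \<and> (\<forall>j<n. \<delta> i * A $$ (i, j) / \<delta> j = \<delta> j * A $$ (j, i) / \<delta> i))"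
proof
  assume "symmetrizable_mat A"
  then obtain D D' where D: "D \<in> carrier_mat n n" "D' \<in> carrier_mat n n" "diagonal_mat D"
    and inv: "D * D' = 1\<^sub>m n" and sym: "transpose_mat (D * A * D') = D * A * D'"
    using A by (auto simp: symmetrizable_mat_def inverts_mat_def)
  define \<delta> where "\<delta> i = D $$ (i, i)" for i
  have D_eq: "D = mat_diag n \<delta>"
    using D by (intro eq_matI) (auto simp: mat_diag_def diagonal_mat_def \<delta>_def)
  have entry: "\<delta> i * D' $$ (i, j) = (if i = j then 1 else 0)" if "i < n" "j < n" for i j
    using arg_cong[OF inv, of "\<lambda>M. M $$ (i, j)"] that D(2)
    by (simp add: D_eq mat_diag_mult_left[of _ n n])
  have nz: "\<delta> i \<noteq> 0" if "i < n" for i using entry[OF that that] by auto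
  have "D' $$ (i, j) = (if i = j then 1 / \<delta> j else 0)" if "i < n" "j < n" for i j
    using entry[OF that] nz[OF that(1)] by (auto simp: field_simps split: if_splits)
  then have D'_eq: "D' = mat_diag n (\<lambda>i. 1 / \<delta> i)"
    using D(2) by (intro eq_matI) (auto simp: mat_diag_def)
  have "(D * A * D') $$ (i, j) = \<delta> i * A $$ (i, j) / \<delta> j" if "i < n" "j < n" for i j
    using that A unfolding D_eq D'_eq
    by (simp add: mat_diag_mult_left[of _ n n] mat_diag_mult_right[of _ n n])
  moreover have "(D * A * D') $$ (i, j) = (D * A * D') $$ (j, i)" if "i < n" "j < n" for i j
    using arg_cong[OF sym, of "\<lambda>M. M $$ (i, j)"] that D A by simp
  ultimately show "\<exists>\<delta>. \<forall>i<n. \<delta> i \<noteq> 0 \<and> (\<forall>j<n. \<delta> i * A $$ (i, j) / \<delta> j = \<delta> j * A $$ (j, i) / \<delta> i)"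
    using nz by metis
next
  assume "\<exists>\<delta>. \<forall>i<n. \<delta> i \<noteq> 0 \<and> (\<forall>j<n. \<delta> i * A $$ (i, j) / \<delta> j = \<delta> j * A $$ (j, i) / \<delta> i)"
  then obtain \<delta> where nz: "\<And>i. i < n \<Longrightarrow> \<delta> i \<noteq> 0"
    and sym: "\<And>i j. i < n \<Longrightarrow> j < n \<Longrightarrow> \<delta> i * A $$ (i, j) / \<delta> j = \<delta> j * A $$ (j, i) / \<delta> i"
    by blast
  define D D' where "D = mat_diag n \<delta>" and "D' = mat_diag n (\<lambda>i. 1 / \<delta> i)"
  have "D * D' = 1\<^sub>m n" "D' * D = 1\<^sub>m n"
    unfolding D_def D'_def mat_diag_diag using nz by (auto simp: mat_diag_def intro!: eq_matI)
  moreover have "transpose_mat (D * A * D') = D * A * D'"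
    using A sym unfolding D_def D'_def
    by (auto simp: mat_diag_mult_left[of _ n n] mat_diag_mult_right[of _ n n] intro!: eq_matI)
  ultimately show "symmetrizable_mat A"
    unfolding symmetrizable_mat_def using A
    by (intro bexI[of _ D] bexI[of _ D'])
      (auto simp: D_def D'_def inverts_mat_def diagonal_mat_def mat_diag_def)
qed

text \<open>Conjugation by the diagonal matrix of the \<open>sqrt (w i)\<close> turns
  self-adjointness for the weighted inner product into symmetry.\<close>

lemma (in weighted_symmetric_mat) symmetrizable: "symmetrizable_mat A"
proof -
  have "sqrt (w i) * A $$ (i, j) / sqrt (w j) = sqrt (w j) * A $$ (j, i) / sqrt (w i)"
    if "i < n" "j < n" for i j
  proof -
    have nz: "sqrt (w i) \<noteq> 0" "sqrt (w j) \<noteq> 0"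
      using w_pos[OF that(1)] w_pos[OF that(2)] by simp_all
    have "sqrt (w i) * sqrt (w i) * A $$ (i, j) = sqrt (w j) * sqrt (w j) * A $$ (j, i)"
      using w_sym[OF that] w_pos[OF that(1)] w_pos[OF that(2)] by simp
    then show ?thesis unfolding frac_eq_eq[OF nz(2,1)] by (simp only: mult_ac)
  qed
  then show ?thesis
    unfolding symmetrizable_mat_iff[OF A] using w_pos
    by (intro exI[of _ "\<lambda>i. sqrt (w i)"]) (metis less_numeral_extra(3) real_sqrt_eq_zero_cancel_iff)
qed

lemma symmetrizable_mat_zero_pattern:
  assumes "A \<in> carrier_mat n n" "symmetrizable_mat A" "i < n" "j < n"
  shows "A $$ (i, j) \<noteq> 0 \<longleftrightarrow> A $$ (j, i) \<noteq> 0"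
proof -
  obtain \<delta> where "\<delta> i \<noteq> 0" "\<delta> j \<noteq> 0" "\<delta> i * A $$ (i, j) / \<delta> j = \<delta> j * A $$ (j, i) / \<delta> i"
    using assms(2-4) unfolding symmetrizable_mat_iff[OF assms(1)] by metis
  then show ?thesis by (metis divide_eq_0_iff mult_eq_0_iff)
qed

section \<open>Assembling the equivalence\<close>

lemma bidirected_path_imp_nonneg_path_mat:
  assumes A: "A \<in> carrier_mat (Suc d) (Suc d)"
    and nonneg: "\<And>i j. i \<le> d \<Longrightarrow> j \<le> d \<Longrightarrow> 0 \<le> A $$ (i, j)"
    and path: "bidirected_path (mat_digraph A) s t"
  obtains x where "nonneg_path_mat d A x"
proof -
  obtain d' x where x: "bij_betw x {..d'} {..<Suc d}"
    and arc: "\<And>i j. i \<le> d' \<Longrightarrow> j \<le> d' \<Longrightarrow>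
      (x i < Suc d \<and> x j < Suc d \<and> x i \<noteq> x j \<and> A $$ (x i, x j) \<noteq> 0) \<longleftrightarrow> \<bar>int i - int j\<bar> = 1"
    using path A unfolding bidirected_path_def dominates_mat_digraph
    by (fastforce simp: mat_digraph_def)
  have d': "d' = d" using bij_betw_same_card[OF x] by simp
  have "nonneg_path_mat d A x"
  proof
    show "bij_betw x {..d} {..d}" using x by (simp add: d' lessThan_Suc_atMost)
    show "A $$ (x i, x j) \<noteq> 0 \<longleftrightarrow> \<bar>int i - int j\<bar> = 1" if "i \<le> d" "j \<le> d" "i \<noteq> j" for i j
      using arc[of i j] that bij_betwE[OF x] inj_onD[OF bij_betw_imp_inj_on[OF x], of i j]
      by (auto simp: d')
  qed (use A nonneg in auto)
  then show ?thesis by (rule that)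
qed

text \<open>By the spectral decomposition the \<open>(s, t)\<close> entries of the powers of
  \<open>A\<close> are the moments of the weights \<open>E i $$ (s, t)\<close> at the nodes
  \<open>\<theta> i\<close>, so the interpolation criterion applies.\<close>

lemma constant_weighted_idempotents_iff:
  assumes A: "A \<in> carrier_mat (Suc d) (Suc d)" and mf: "multiplicity_free_mat A"
    and "s \<le> d" "t \<le> d"
    and bij: "bij_betw \<theta> {..d} (spectrum A)"
    and E: "\<And>i. i \<le> d \<Longrightarrow> primitive_idempotent A (\<theta> i) (E i)"
  shows "(\<forall>i\<le>d. E i $$ (s, t) * (\<Prod>j\<in>{..d} - {i}. \<theta> i - \<theta> j) = c) \<longleftrightarrow>
    (\<forall>k<d. (A ^\<^sub>m k) $$ (s, t) = 0) \<and> (A ^\<^sub>m d) $$ (s, t) = c"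
proof -
  obtain as where sim: "similar_mat A (mat_diag (length as) ((!) as))"
    using mf unfolding multiplicity_free_mat_iff by blast
  have "length as = Suc d"
    using sim A carrier_matD(1)[OF mat_diag_dim[of "length as" "(!) as"]]
    by (metis carrier_matD(1) similar_mat_def similar_mat_witD2(5))
  then have pow: "(A ^\<^sub>m k) $$ (s, t) = (\<Sum>i\<le>d. \<theta> i ^ k * E i $$ (s, t))" for k
    using pow_mat_eq_sum_idempotents[OF A _ finite_atMost bij, of "(!) as" E s t] sim E assms(3,4)
    by simp
  show ?thesis
    unfolding pow
    using constant_weights_iff_moments[of "{..d}" d \<theta> "\<lambda>i. E i $$ (s, t)" c]
      bij_betw_imp_inj_on[OF bij] by (simp add: Ball_def)
qed

text \<open>The theorem quantifies universally over such \<open>\<theta>\<close> and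
  \<open>E\<close>; an instance ensures that its condition is not vacuous.\<close>

lemma multiplicity_free_idempotents_exist:
  assumes A: "A \<in> carrier_mat (Suc d) (Suc d)" and mf: "multiplicity_free_mat A"
  obtains \<theta> E where "bij_betw \<theta> {..d} (spectrum A)" "\<And>i. i \<le> d \<Longrightarrow> primitive_idempotent A (\<theta> i) (E i)"
proof -
  obtain as where as: "distinct as" and sim: "similar_mat A (mat_diag (length as) ((!) as))"
    using mf unfolding multiplicity_free_mat_iff by blast
  have len: "length as = Suc d"
    using sim A carrier_matD(1)[OF mat_diag_dim[of "length as" "(!) as"]]
    by (metis carrier_matD(1) similar_mat_def similar_mat_witD2(5))
  have bij: "bij_betw ((!) as) {..<Suc d} (spectrum A)"
    unfolding spectrum_similar_diag[OF sim] len[symmetric] by (rule bij_betw_nth[OF as refl refl])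
  have "\<exists>E. primitive_idempotent A (as ! i) E" if "i \<le> d" for i
    using primitive_idempotent_exists[OF A sim[unfolded len] bij_betw_imp_inj_on[OF bij]] that by simp
  then obtain E where "\<And>i. i \<le> d \<Longrightarrow> primitive_idempotent A (as ! i) (E i)" by metis
  with bij show ?thesis by (intro that[of "(!) as" E]) (auto simp: lessThan_Suc_atMost)
qed

theorem theorem1p3:
  fixes d :: nat and A :: "real mat" and s t :: nat
  assumes "A \<in> carrier_mat (d + 1) (d + 1)"
    and "\<forall>i\<le>d. \<forall>j\<le>d. 0 \<le> A $$ (i, j)"
    and "s \<le> d" and "t \<le> d"
  shows "bidirected_path (mat_digraph A) s t \<longleftrightarrow>
    symmetrizable_mat A \<and> multiplicity_free_mat A \<and>
    (\<forall>(\<theta> :: nat \<Rightarrow> real) (E :: nat \<Rightarrow> real mat).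
       bij_betw \<theta> {..d} (spectrum A) \<and> (\<forall>i\<le>d. primitive_idempotent A (\<theta> i) (E i)) \<longrightarrow>
       (\<exists>c :: real. c \<noteq> 0 \<and>
          (\<forall>i\<le>d. (E i) $$ (s, t) * (\<Prod>j\<in>{..d} - {i}. \<theta> i - \<theta> j) = c)))"
    (is "?path \<longleftrightarrow> _ \<and> _ \<and> ?const")
proof -
  have A: "A \<in> carrier_mat (Suc d) (Suc d)" using assms(1) by simp
  \<comment> \<open>By nonnegativity this says that the shortest walk from \<open>s\<close> to
    \<open>t\<close> has length exactly \<open>d\<close>.\<close>
  let ?short = "(\<forall>k<d. (A ^\<^sub>m k) $$ (s, t) = 0) \<and> (A ^\<^sub>m d) $$ (s, t) \<noteq> 0"
  have "(A ^\<^sub>m k) $$ (s, t) \<noteq> 0 \<longleftrightarrow> (s, t) \<in> mat_rel A ^^ k" for k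
    using nonneg_pow_mat_entry[OF A, of s t k] assms by (simp add: less_Suc_eq_le)
  then have path_iff: "?path \<longleftrightarrow> (\<forall>i\<le>d. \<forall>j\<le>d. A $$ (i, j) \<noteq> 0 \<longleftrightarrow> A $$ (j, i) \<noteq> 0) \<and> ?short"
    unfolding bidirected_path_iff_shortest_walk[OF A assms(3,4)] by blast
  \<comment> \<open>This removes the choice of \<open>\<theta>\<close> and \<open>E\<close>. One
    direction instantiates \<open>?const\<close> at an existing system; in the other the constant is
    \<open>(A ^\<^sub>m d) $$ (s, t)\<close> for every choice.\<close>
  have const_iff: "?const \<longleftrightarrow> ?short" if mf: "multiplicity_free_mat A"
  proof
    assume const: ?const
    obtain \<theta> E where bij: "bij_betw \<theta> {..d} (spectrum A)"
      and E: "\<And>i. i \<le> d \<Longrightarrow> primitive_idempotent A (\<theta> i) (E i)"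
      using multiplicity_free_idempotents_exist[OF A mf] by metis
    obtain c where "c \<noteq> 0" "\<forall>i\<le>d. (E i) $$ (s, t) * (\<Prod>j\<in>{..d} - {i}. \<theta> i - \<theta> j) = c"
      using const bij E by blast
    then show ?short
      using constant_weighted_idempotents_iff[OF A mf assms(3,4) bij E, of c] by simp
  next
    assume short: ?short
    show ?const
    proof (intro allI impI, elim conjE)
      fix \<theta> E
      assume bij: "bij_betw \<theta> {..d} (spectrum A)" and "\<forall>i\<le>d. primitive_idempotent A (\<theta> i) (E i)"
      then have E: "\<And>i. i \<le> d \<Longrightarrow> primitive_idempotent A (\<theta> i) (E i)" by blast
      show "\<exists>c. c \<noteq> 0 \<and> (\<forall>i\<le>d. (E i) $$ (s, t) * (\<Prod>j\<in>{..d} - {i}. \<theta> i - \<theta> j) = c)"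
        using constant_weighted_idempotents_iff[OF A mf assms(3,4) bij E, of "(A ^\<^sub>m d) $$ (s, t)"] short
        by blast
    qed
  qed
  have "symmetrizable_mat A \<and> multiplicity_free_mat A" if path: ?path
  proof -
    obtain x where "nonneg_path_mat d A x"
      using bidirected_path_imp_nonneg_path_mat[OF A _ path] assms(2) by blast
    then interpret nonneg_path_mat d A x .
    show ?thesis using symmetrizable multiplicity_free by blast
  qed
  \<comment> \<open>For the converse, symmetrizability contributes the symmetric zero pattern that
    \<open>path_iff\<close> asks for.\<close>
  moreover have "\<forall>i\<le>d. \<forall>j\<le>d. A $$ (i, j) \<noteq> 0 \<longleftrightarrow> A $$ (j, i) \<noteq> 0" if "symmetrizable_mat A"
    using symmetrizable_mat_zero_pattern[OF A that] by (simp add: less_Suc_eq_le)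
  ultimately show ?thesis using path_iff const_iff by blast
qed

end
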